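(* There is no PPL-complete problem under DLOGTIME reductions; that is, there is no problem $\mathcal{P}\in$ PPL such that every problem in PPL is DLOGTIME-reducible to $\mathcal{P}$.
   Context: A random-access Turing machine (RATM) is a multitape Turing machine with a read-only input tape and work tapes, each with an associated binary index tape, and a special random-access state that in one step moves each non-index tape head to the cell addressed by its index tape. For $i\ge1$, $\mathrm{PPL}^i$ is the class of problems solvable by an RATM in time $O(\log^i n)$, where $n$ is the input length, and $\mathrm{PPL}=\bigcup_i \mathrm{PPL}^i$ (problems solvable by an RATM in $O(\mathrm{polylog}(n))$ time). A DLOGTIME reduction from $\mathcal{P}_1$ to $\mathcal{P}_2$ is a function $f$ with $x\in\mathcal{P}_1\iff f(x)\in\mathcal{P}_2$, $|f(x)|$ polynomially bounded in $|x|$, and such that, given $x$ and an index $i$, the $i$-th symbol of $f(x)$ (and the length of $f(x)$) can be computed by an RATM in time $O(\log|x|)$. *)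

theory Defs
  imports Complex_Main
begin

datatype sym = Bl | S0 | S1

definition sym_of :: "bool \<Rightarrow> sym" where
  "sym_of b = (if b then S1 else S0)"

text \<open>A RATM with k = ntapes work tapes.  The tapes are numbered as follows:
  tape 0 = read-only input tape, tape 1 = its binary index tape,
  tape 2+2j = work tape j, tape 3+2j = index tape of work tape j (j < k).
  Even-numbered tapes are the non-index tapes, odd-numbered ones the index tapes.
  States are natural numbers below nstates; the transition function maps the
  current state and the symbols under all 2k+2 heads to a new state, the symbols
  to be written (ignored for the read-only input tape) and head moves in {-1,0,1}.\<close>
record ratm =
  ntapes :: nat
  nstates :: nat
  start :: nat
  ra_state :: nat
  acc_state :: nat
  rej_state :: nat
  delta :: "nat \<Rightarrow> sym list \<Rightarrow> nat \<times> sym list \<times> int list"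

definition ntot :: "ratm \<Rightarrow> nat" where
  "ntot M = 2 * ntapes M + 2"

definition wf_ratm :: "ratm \<Rightarrow> bool" where
  "wf_ratm M \<longleftrightarrow>
     start M < nstates M \<and> ra_state M < nstates M \<and> acc_state M < nstates M \<and>
     rej_state M < nstates M \<and> acc_state M \<noteq> rej_state M \<and>
     ra_state M \<noteq> acc_state M \<and> ra_state M \<noteq> rej_state M \<and>
     (\<forall>q ss. q < nstates M \<longrightarrow> length ss = ntot M \<longrightarrow>
        (case delta M q ss of (q', W, D) \<Rightarrow>
           q' < nstates M \<and> length W = ntot M \<and> length D = ntot M \<and>
           (\<forall>d \<in> set D. d \<in> {-1, 0, 1})))"

text \<open>Configurations: state, tape contents, head positions.\<close>
type_synonym config = "nat \<times> (nat \<Rightarrow> sym) list \<times> nat list"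

definition bin_val :: "(nat \<Rightarrow> sym) \<Rightarrow> nat" where
  "bin_val t = (\<Sum>i < (LEAST m. t m = Bl). if t i = S1 then 2 ^ i else 0)"

definition step :: "ratm \<Rightarrow> config \<Rightarrow> config" where
  "step M c = (case c of (q, T, H) \<Rightarrow>
     if q = acc_state M \<or> q = rej_state M then c
     else
       (let ss = map (\<lambda>j. (T ! j) (H ! j)) [0..<ntot M] in
        case delta M q ss of (q', W, D) \<Rightarrow>
          if q = ra_state M then
            \<comment> \<open>random-access step: every non-index head jumps to the cell addressed by its index tape\<close>
            (q', T, map (\<lambda>j. if even j then bin_val (T ! (j + 1)) else H ! j) [0..<ntot M])
          else
            (q',
             map (\<lambda>j. if j = 0 then T ! 0 else (T ! j)((H ! j) := W ! j)) [0..<ntot M],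
             map (\<lambda>j. nat (int (H ! j) + D ! j)) [0..<ntot M])))"

definition input_tape :: "bool list \<Rightarrow> nat \<Rightarrow> sym" where
  "input_tape x i = (if i < length x then sym_of (x ! i) else Bl)"

definition list_tape :: "sym list \<Rightarrow> nat \<Rightarrow> sym" where
  "list_tape w i = (if i < length w then w ! i else Bl)"

text \<open>Initial configuration on input x, with the list w initially written on
  work tape 0 (used for the extra index argument of reductions; w = [] otherwise).\<close>
definition init :: "ratm \<Rightarrow> bool list \<Rightarrow> sym list \<Rightarrow> config" where
  "init M x w = (start M,
     map (\<lambda>j. if j = 0 then input_tape x else if j = 2 then list_tape w else (\<lambda>_. Bl)) [0..<ntot M],
     replicate (ntot M) 0)"

definition run :: "ratm \<Rightarrow> nat \<Rightarrow> config \<Rightarrow> config" where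
  "run M t c = (step M ^^ t) c"

definition answers_within :: "ratm \<Rightarrow> bool list \<Rightarrow> sym list \<Rightarrow> real \<Rightarrow> bool \<Rightarrow> bool" where
  "answers_within M x w bound b \<longleftrightarrow>
     (\<exists>t. real t \<le> bound \<and>
        fst (run M t (init M x w)) = (if b then acc_state M else rej_state M))"

definition PPL_i :: "nat \<Rightarrow> bool list set set" where
  "PPL_i i = {P. \<exists>M (c::real). wf_ratm M \<and>
      (\<forall>x. answers_within M x [] (c * (log 2 (real (length x) + 2)) ^ i) (x \<in> P))}"

definition PPL :: "bool list set set" where
  "PPL = (\<Union>i \<in> {1..}. PPL_i i)"

fun bin :: "nat \<Rightarrow> sym list" where
  "bin n = (if n = 0 then [] else (if odd n then S1 else S0) # bin (n div 2))"

definition dlogtime_reduction ::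
  "(bool list \<Rightarrow> bool list) \<Rightarrow> bool list set \<Rightarrow> bool list set \<Rightarrow> bool" where
  "dlogtime_reduction f P1 P2 \<longleftrightarrow>
     (\<forall>x. x \<in> P1 \<longleftrightarrow> f x \<in> P2) \<and>
     (\<exists>(c::nat) d. \<forall>x. length (f x) \<le> c * length x ^ d + c) \<and>
     \<comment> \<open>the i-th symbol of f(x) is computable in time O(log |x|)\<close>
     (\<exists>M (c::real). wf_ratm M \<and> ntapes M \<ge> 1 \<and>
        (\<forall>x i. i < length (f x) \<longrightarrow>
           answers_within M x (bin i) (c * log 2 (real (length x) + 2)) (f x ! i))) \<and>
     \<comment> \<open>the length of f(x) is computable in time O(log |x|) (decision version: is i < |f(x)|?)\<close>
     (\<exists>M (c::real). wf_ratm M \<and> ntapes M \<ge> 1 \<and>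
        (\<forall>x i. answers_within M x (bin i) (c * log 2 (real (length x) + 2)) (i < length (f x))))"

definition dlogtime_reducible :: "bool list set \<Rightarrow> bool list set \<Rightarrow> bool" where
  "dlogtime_reducible P1 P2 \<longleftrightarrow> (\<exists>f. dlogtime_reduction f P1 P2)"

end

theory Submission
  imports Defs "HOL-Library.Nat_Bijection"
begin

text \<open>The argument counts queries.  A run of \<open>t\<close> steps depends on at most \<open>t\<close> input
  cells.  If \<open>P\<close> is decided in time \<open>O(log\<^sup>i n)\<close> and \<open>Q\<close> reduces to \<open>P\<close> via \<open>f\<close>, then membership of
  \<open>x\<close> in \<open>Q\<close> depends on \<open>O(log\<^sup>i n)\<close> cells of \<open>f x\<close>, each of which depends on \<open>O(log n)\<close> cells of
  \<open>x\<close>; so \<open>Q\<close> has certificates of \<open>O(log\<^bsup>i+1\<^esup> n)\<close> cells.  Take for \<open>Q\<close> the problem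
  whether \<open>x\<close> vanishes at all even positions with exactly \<open>k = i + 2\<close> ones in binary.
  On the zero string every one of these roughly \<open>log\<^sup>k n / k!\<close> positions must be in a certificate,
  although a depth-first search over the index tape decides \<open>Q\<close> in polylogarithmic time.\<close>

section \<open>Certificates for RATM computations\<close>

lemma run_0 [simp]: "run M 0 c = c"
  by (simp add: run_def)

lemma run_Suc: "run M (Suc t) c = step M (run M t c)"
  by (simp add: run_def)

lemma run_add: "run M (s + t) c = run M t (run M s c)"
  by (simp add: run_def funpow_add add.commute[of s])

lemma run_halted:
  assumes "fst c = acc_state M \<or> fst c = rej_state M"
  shows "run M t c = c"
proof (induction t)
  case (Suc t)
  then show ?case using assms by (cases c) (simp add: run_Suc step_def)
qed simp

text \<open>Halting configurations are fixed points of \<open>step\<close>, so both runs can be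
  extended to the common length \<open>t + t'\<close>, where they coincide. The two time bounds need
  not be related.\<close>

lemma answers_within_unique:
  assumes wf: "wf_ratm M"
    and "answers_within M x w B b" and "answers_within M x w B' b'"
  shows "b = b'"
proof -
  obtain t where t: "fst (run M t (init M x w)) = (if b then acc_state M else rej_state M)"
    using assms(2) by (auto simp: answers_within_def)
  obtain t' where t': "fst (run M t' (init M x w)) = (if b' then acc_state M else rej_state M)"
    using assms(3) by (auto simp: answers_within_def)
  have "run M (t + t') (init M x w) = run M t (init M x w)"
    unfolding run_add by (rule run_halted) (use t in auto)
  moreover have "run M (t' + t) (init M x w) = run M t' (init M x w)"
    unfolding run_add by (rule run_halted) (use t' in auto)
  ultimately have "(if b then acc_state M else rej_state M) = (if b' then acc_state M else rej_state M)"
    using t t' by (simp add: add.commute)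
  then show ?thesis using wf by (auto simp: wf_ratm_def split: if_splits)
qed

section \<open>Dependence of a run on the inspected input cells\<close>

definition input_head :: "config \<Rightarrow> nat" where
  "input_head c = snd (snd c) ! 0"

definition with_input :: "(nat \<Rightarrow> sym) \<Rightarrow> config \<Rightarrow> config" where
  "with_input u c = (fst c, (fst (snd c))[0 := u], snd (snd c))"

lemma length_tapes_step:
  "length (fst (snd c)) = ntot M \<Longrightarrow> length (fst (snd (step M c))) = ntot M"
  by (cases c) (auto simp: step_def Let_def split: prod.splits)

lemma ntot_pos: "0 < ntot M"
  by (simp add: ntot_def)

lemma input_preserved_step:
  assumes "length (fst (snd c)) = ntot M"
  shows "fst (snd (step M c)) ! 0 = fst (snd c) ! 0"
  using assms ntot_pos[of M] by (cases c) (auto simp: step_def Let_def split: prod.splits)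

text \<open>The input tape enters a step only through the symbol under its head: jumps read
  odd-numbered tapes, and tape 0 is never written.\<close>

lemma step_with_input:
  assumes len: "length (fst (snd c)) = ntot M"
    and eq: "(fst (snd c) ! 0) (input_head c) = u (input_head c)"
  shows "step M (with_input u c) = with_input u (step M c)"
proof -
  obtain q T H where c: "c = (q, T, H)" by (cases c)
  have T: "length T = ntot M" "(T ! 0) (H ! 0) = u (H ! 0)"
    using assms by (simp_all add: c input_head_def)
  have reads: "map (\<lambda>j. (T[0 := u] ! j) (H ! j)) [0..<ntot M] = map (\<lambda>j. (T ! j) (H ! j)) [0..<ntot M]"
    using T ntot_pos[of M] by (auto simp: nth_list_update)
  have jumps: "map (\<lambda>j. if even j then bin_val (T[0 := u] ! (j + 1)) else H ! j) [0..<ntot M]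
      = map (\<lambda>j. if even j then bin_val (T ! (j + 1)) else H ! j) [0..<ntot M]"
    by auto
  have writes: "map (\<lambda>j. if j = 0 then T[0 := u] ! 0 else (T[0 := u] ! j)(H ! j := W ! j)) [0..<ntot M]
      = (map (\<lambda>j. if j = 0 then T ! 0 else (T ! j)(H ! j := W ! j)) [0..<ntot M])[0 := u]" for W
    using T ntot_pos[of M] by (intro nth_equalityI) (auto simp: nth_list_update)
  show ?thesis
    unfolding c with_input_def step_def
    by (simp add: reads jumps writes Let_def split: prod.splits)
qed

lemma init_tapes: "length (fst (snd (init M x w))) = ntot M"
    "fst (snd (init M x w)) ! 0 = input_tape x"
  using ntot_pos[of M] by (simp_all add: init_def)

lemma run_tapes:
  "length (fst (snd (run M t (init M x w)))) = ntot M
    \<and> fst (snd (run M t (init M x w))) ! 0 = input_tape x"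
  by (induction t) (simp_all add: run_Suc init_tapes length_tapes_step input_preserved_step)

lemma init_with_input: "init M x' w = with_input (input_tape x') (init M x w)"
  using ntot_pos[of M]
  by (auto simp: init_def with_input_def nth_list_update intro!: nth_equalityI)

lemma run_with_input:
  assumes "\<And>s. s < t \<Longrightarrow> input_tape x (input_head (run M s (init M x w)))
      = input_tape x' (input_head (run M s (init M x w)))"
  shows "run M t (init M x' w) = with_input (input_tape x') (run M t (init M x w))"
  using assms
proof (induction t)
  case 0
  show ?case by (simp add: init_with_input[of M x' w x])
next
  case (Suc t)
  then show ?case
    using run_tapes[of M t x w] by (simp add: run_Suc step_with_input)
qed

text \<open>\<open>S\<close> collects the input head positions of the first \<open>t\<close> steps.
  The string \<open>x'\<close> may have another length than \<open>x\<close>; the bound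
  \<open>B\<close> stays the one for \<open>x\<close>.\<close>

lemma answers_within_certificate:
  assumes "answers_within M x w B b"
  obtains S where "finite S" "real (card S) \<le> B"
    "\<And>x'. (\<And>p. p \<in> S \<Longrightarrow> input_tape x p = input_tape x' p) \<Longrightarrow> answers_within M x' w B b"
proof -
  obtain t where t: "real t \<le> B"
      "fst (run M t (init M x w)) = (if b then acc_state M else rej_state M)"
    using assms by (auto simp: answers_within_def)
  define S where "S = (\<lambda>s. input_head (run M s (init M x w))) ` {..<t}"
  have "card S \<le> t" unfolding S_def using card_image_le[of "{..<t}"] by fastforce
  then have "real (card S) \<le> B" using t(1) by linarith
  moreover have "answers_within M x' w B b"
    if "\<And>p. p \<in> S \<Longrightarrow> input_tape x p = input_tape x' p" for x'
  proof -
    have "run M t (init M x' w) = with_input (input_tape x') (run M t (init M x w))"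
      by (rule run_with_input) (use that in \<open>auto simp: S_def\<close>)
    then show ?thesis using t by (auto simp: answers_within_def with_input_def)
  qed
  ultimately show thesis using that[of S] by (simp add: S_def)
qed

text \<open>A reduction composed with a decision procedure still inspects few input cells: each
  inspected cell of the image is determined by one length query and one symbol query.\<close>

lemma reduction_certificate:
  assumes red: "dlogtime_reduction f Q P" and P: "P \<in> PPL_i i"
  obtains C :: real where
    "\<And>x. \<exists>S. finite S \<and> real (card S) \<le> C * log 2 (real (length x) + 2) ^ (i + 1)
        \<and> (\<forall>x'. (\<forall>p\<in>S. input_tape x p = input_tape x' p) \<longrightarrow> (x' \<in> Q \<longleftrightarrow> x \<in> Q))"
proof -
  obtain M c where M: "wf_ratm M"
    "\<And>y. answers_within M y [] (c * log 2 (real (length y) + 2) ^ i) (y \<in> P)"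
    using P by (auto simp: PPL_i_def)
  obtain a d where poly: "\<And>x. length (f x) \<le> a * length x ^ d + a"
    using red unfolding dlogtime_reduction_def by blast
  obtain N e where N: "wf_ratm N"
    "\<And>x j. j < length (f x) \<Longrightarrow>
       answers_within N x (bin j) (e * log 2 (real (length x) + 2)) (f x ! j)"
    using red unfolding dlogtime_reduction_def by blast
  obtain N' e' where N': "wf_ratm N'"
    "\<And>x j. answers_within N' x (bin j) (e' * log 2 (real (length x) + 2)) (j < length (f x))"
    using red unfolding dlogtime_reduction_def by blast
  have red_iff: "x \<in> Q \<longleftrightarrow> f x \<in> P" for x
    using red by (simp add: dlogtime_reduction_def)
  \<comment> \<open>With \<open>m = length x + 2\<close>, the size bound on \<open>f\<close> gives
    \<open>length (f x) + 2 \<le> (2a + 2) m^d\<close>; as \<open>log 2 m \<ge> 1\<close>, the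
    constant \<open>log 2 (2a + 2)\<close> is absorbed into the factor.\<close>
  define D where "D = log 2 (2 * real a + 2) + real d"
  have log_image: "log 2 (real (length (f x)) + 2) \<le> D * log 2 (real (length x) + 2)" for x
  proof -
    define m where "m = real (length x) + 2"
    have m: "2 \<le> m" "1 \<le> log 2 m" by (auto simp: m_def le_log_iff)
    have "real (length (f x)) \<le> real (a * length x ^ d + a)"
      using poly of_nat_le_iff by blast
    also have "\<dots> \<le> real a * m ^ d + real a * m ^ d"
    proof -
      have "real (length x) ^ d \<le> m ^ d" by (rule power_mono) (simp_all add: m_def)
      moreover have "1 \<le> m ^ d" using m(1) by simp
      ultimately have "real a * real (length x) ^ d \<le> real a * m ^ d" "real a * 1 \<le> real a * m ^ d"
        by (auto simp only: intro: mult_left_mono)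
      then show ?thesis by simp
    qed
    finally have image: "real (length (f x)) \<le> real a * m ^ d + real a * m ^ d" .
    have "real (length (f x)) + 2 \<le> (2 * real a + 2) * m ^ d"
    proof -
      have "1 \<le> m ^ d" using m(1) by simp
      then show ?thesis
        using image by (simp add: algebra_simps)
    qed
    then have "log 2 (real (length (f x)) + 2) \<le> log 2 ((2 * real a + 2) * m ^ d)"
      by (intro log_mono) auto
    also have "\<dots> = log 2 (2 * real a + 2) + real d * log 2 m"
      using m by (simp add: log_mult log_nat_power)
    also have "\<dots> \<le> log 2 (2 * real a + 2) * log 2 m + real d * log 2 m"
      using m mult_left_mono[of 1 "log 2 m" "log 2 (2 * real a + 2)"] by simp
    finally show ?thesis by (simp add: D_def m_def algebra_simps)
  qed
  \<comment> \<open>At most \<open>\<bar>c\<bar> * (D * l) ^ i\<close> image cells are inspected,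
    each at the price of \<open>(\<bar>e\<bar> + \<bar>e'\<bar>) * l\<close> input cells. Absolute
    values appear because the given constants carry no sign condition.\<close>
  define C where "C = \<bar>c\<bar> * D ^ i * (\<bar>e\<bar> + \<bar>e'\<bar>)"
  have "\<exists>S. finite S \<and> real (card S) \<le> C * log 2 (real (length x) + 2) ^ (i + 1)
        \<and> (\<forall>x'. (\<forall>p\<in>S. input_tape x p = input_tape x' p) \<longrightarrow> (x' \<in> Q \<longleftrightarrow> x \<in> Q))" for x
  proof -
    define l where "l = log 2 (real (length x) + 2)"
    have l: "1 \<le> l" by (simp add: l_def le_log_iff)
    obtain U where U: "finite U" "real (card U) \<le> c * log 2 (real (length (f x)) + 2) ^ i"
      "\<And>y. (\<And>p. p \<in> U \<Longrightarrow> input_tape (f x) p = input_tape y p)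
        \<Longrightarrow> answers_within M y [] (c * log 2 (real (length (f x)) + 2) ^ i) (f x \<in> P)"
      by (rule answers_within_certificate[OF M(2)[of "f x"]]) blast
    have "\<exists>S. finite S \<and> real (card S) \<le> (\<bar>e\<bar> + \<bar>e'\<bar>) * l \<and>
        (\<forall>x'. (\<forall>p\<in>S. input_tape x p = input_tape x' p) \<longrightarrow>
          input_tape (f x) j = input_tape (f x') j)" for j
    proof -
      obtain S' where S': "finite S'" "real (card S') \<le> e' * l"
        "\<And>x'. (\<And>p. p \<in> S' \<Longrightarrow> input_tape x p = input_tape x' p)
          \<Longrightarrow> answers_within N' x' (bin j) (e' * l) (j < length (f x))"
        unfolding l_def by (rule answers_within_certificate[OF N'(2)[of x j]]) blast
      have len: "j < length (f x') \<longleftrightarrow> j < length (f x)"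
        if "\<And>p. p \<in> S' \<Longrightarrow> input_tape x p = input_tape x' p" for x'
        using answers_within_unique[OF N'(1) N'(2)[of x' j] S'(3)[OF that]] .
      have le: "e * l \<le> \<bar>e\<bar> * l" "e' * l \<le> \<bar>e'\<bar> * l" "0 \<le> \<bar>e\<bar> * l"
        using l by (auto intro!: mult_right_mono)
      \<comment> \<open>Beyond the end of \<open>f x\<close> the image cell is blank, and the length
        query alone certifies this.\<close>
      show ?thesis
      proof (cases "j < length (f x)")
        case False
        show ?thesis
        proof (intro exI[of _ S'] conjI allI impI)
          show "real (card S') \<le> (\<bar>e\<bar> + \<bar>e'\<bar>) * l"
            using S'(2) le by (simp add: distrib_right)
          show "input_tape (f x) j = input_tape (f x') j"
            if "\<forall>p\<in>S'. input_tape x p = input_tape x' p" for x'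
            using len[of x'] that False by (simp add: input_tape_def)
        qed (fact S'(1))
      next
        case True
        obtain S where S: "finite S" "real (card S) \<le> e * l"
          "\<And>x'. (\<And>p. p \<in> S \<Longrightarrow> input_tape x p = input_tape x' p)
            \<Longrightarrow> answers_within N x' (bin j) (e * l) (f x ! j)"
          unfolding l_def by (rule answers_within_certificate[OF N(2)[OF True]]) blast
        show ?thesis
        proof (intro exI[of _ "S \<union> S'"] conjI allI impI)
          have "real (card (S \<union> S')) \<le> real (card S) + real (card S')"
            using card_Un_le[of S S'] by linarith
          then show "real (card (S \<union> S')) \<le> (\<bar>e\<bar> + \<bar>e'\<bar>) * l"
            using S(2) S'(2) le by (simp add: distrib_right)
          show "input_tape (f x) j = input_tape (f x') j"
            if "\<forall>p\<in>S \<union> S'. input_tape x p = input_tape x' p" for x'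
          proof -
            \<comment> \<open>The machine \<open>N\<close> promises an answer on \<open>x'\<close>
              only for indices within \<open>f x'\<close>, so the length certificate has to be used
              first.\<close>
            have j: "j < length (f x')" using len[of x'] that True by blast
            have "f x' ! j = f x ! j"
              using answers_within_unique[OF N(1) N(2)[OF j] S(3)[of x']] that by blast
            then show ?thesis using j True by (simp add: input_tape_def)
          qed
        qed (use S(1) S'(1) in simp)
      qed
    qed
    then obtain V where V: "\<And>j. finite (V j)" "\<And>j. real (card (V j)) \<le> (\<bar>e\<bar> + \<bar>e'\<bar>) * l"
      "\<And>j x'. (\<forall>p\<in>V j. input_tape x p = input_tape x' p) \<Longrightarrow>
          input_tape (f x) j = input_tape (f x') j"
      by metis
    define S where "S = (\<Union>j\<in>U. V j)"
    have "real (card S) \<le> real (\<Sum>j\<in>U. card (V j))"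
      unfolding S_def using card_UN_le[OF U(1)] of_nat_le_iff by blast
    also have "\<dots> \<le> real (card U) * ((\<bar>e\<bar> + \<bar>e'\<bar>) * l)"
      using sum_bounded_above[of U "\<lambda>j. real (card (V j))"] V(2) by simp
    also have "\<dots> \<le> (\<bar>c\<bar> * (D * l) ^ i) * ((\<bar>e\<bar> + \<bar>e'\<bar>) * l)"
    proof (rule mult_right_mono)
      have "log 2 (real (length (f x)) + 2) ^ i \<le> (D * l) ^ i"
        using log_image[of x] by (intro power_mono) (auto simp: l_def)
      then have "c * log 2 (real (length (f x)) + 2) ^ i \<le> \<bar>c\<bar> * (D * l) ^ i"
        by (intro mult_mono) auto
      then show "real (card U) \<le> \<bar>c\<bar> * (D * l) ^ i" using U(2) by linarith
    qed (use l in simp)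
    also have "\<dots> = C * l ^ (i + 1)"
      by (simp add: C_def power_mult_distrib)
    finally have "real (card S) \<le> C * l ^ (i + 1)" .
    moreover have "x' \<in> Q \<longleftrightarrow> x \<in> Q" if "\<forall>p\<in>S. input_tape x p = input_tape x' p" for x'
    proof -
      \<comment> \<open>The images \<open>f x\<close> and \<open>f x'\<close> agree on
        \<open>U\<close>, so the answer of \<open>M\<close> on \<open>f x\<close> transfers to
        \<open>f x'\<close>.\<close>
      have "answers_within M (f x') [] (c * log 2 (real (length (f x)) + 2) ^ i) (f x \<in> P)"
        by (rule U(3), rule V(3)) (use that in \<open>auto simp: S_def\<close>)
      from answers_within_unique[OF M(1) M(2)[of "f x'"] this] show ?thesis
        by (simp add: red_iff)
    qed
    moreover have "finite S" using U(1) V(1) by (simp add: S_def)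
    ultimately show ?thesis unfolding l_def by blast
  qed
  then show thesis by (rule that)
qed


section \<open>A problem with many sensitive positions\<close>

text \<open>The first exponent \<open>h \<ge> 1\<close> at which cell \<open>2 ^ h\<close> of an
  input of length \<open>n\<close> is blank, which is what a doubling search finds. Starting at 1
  keeps bit 0 free as a sentinel.\<close>

definition probe_len :: "nat \<Rightarrow> nat" where
  "probe_len n = (LEAST h. 1 \<le> h \<and> n \<le> 2 ^ h)"

text \<open>\<open>set_encode B\<close> is the number whose binary ones are at the places in
  \<open>B\<close>; leaving out bit 0 makes it even. The condition is \<open>\<noteq> S1\<close>
  because such a position may lie past the end of \<open>x\<close>.\<close>

definition sparse_zero :: "nat \<Rightarrow> bool list set" where
  "sparse_zero k = {x. \<forall>B. B \<subseteq> {1..<probe_len (length x)} \<and> card B = k \<longrightarrow>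
     input_tape x (set_encode B) \<noteq> S1}"

lemma probe_len: "1 \<le> probe_len n" "n \<le> 2 ^ probe_len n"
proof -
  have "1 \<le> Suc n \<and> n \<le> 2 ^ Suc n"
    using less_exp[of "Suc n"] by linarith
  then have "1 \<le> probe_len n \<and> n \<le> 2 ^ probe_len n"
    unfolding probe_len_def by (rule LeastI)
  then show "1 \<le> probe_len n" "n \<le> 2 ^ probe_len n" by auto
qed

lemma less_probe_len: "1 \<le> h \<Longrightarrow> h < probe_len n \<Longrightarrow> 2 ^ h < n"
  unfolding probe_len_def using not_less_Least by (metis (mono_tags, lifting) not_le)

lemma probe_len_power: "1 \<le> h \<Longrightarrow> probe_len (2 ^ h) = h"
  unfolding probe_len_def by (rule Least_equality) auto

lemma probe_len_le_log: "real (probe_len n) \<le> 1 + log 2 (real n + 2)"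
proof (cases "probe_len n = 1")
  case False
  then have "2 ^ (probe_len n - 1) < n" using less_probe_len probe_len(1)[of n] by auto
  then have "real (2 ^ (probe_len n - 1)) < real n" by (simp only: of_nat_less_iff)
  then have "2 powr real (probe_len n - 1) \<le> real n + 2"
    unfolding of_nat_power of_nat_numeral by (subst powr_realpow) linarith+
  then have "real (probe_len n - 1) \<le> log 2 (real n + 2)" by (simp add: le_log_iff)
  then show ?thesis by linarith
qed simp

lemma set_encode_less_power: "A \<subseteq> {..<h} \<Longrightarrow> set_encode A < 2 ^ h"
proof -
  assume A: "A \<subseteq> {..<h}"
  have "set_encode A \<le> (\<Sum>i<h. 2 ^ i)"
    unfolding set_encode_def using A by (intro sum_mono2) auto
  also have "\<dots> < 2 ^ h" by (simp add: lessThan_atLeast0 sum_power2)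
  finally show ?thesis .
qed

text \<open>Switching one probed cell of the zero string to 1 leaves the problem, so a certificate
  contains all probed cells. By injectivity of \<open>set_encode\<close> they number
  \<open>(h - 1) choose k\<close>.\<close>

lemma sparse_zero_certificate:
  assumes h: "1 \<le> h" and "finite S"
    and cert: "\<And>x'. (\<And>p. p \<in> S \<Longrightarrow> input_tape (replicate (2 ^ h) False) p = input_tape x' p)
        \<Longrightarrow> x' \<in> sparse_zero k \<longleftrightarrow> replicate (2 ^ h) False \<in> sparse_zero k"
  shows "(h - 1) choose k \<le> card S"
proof -
  let ?z = "replicate (2 ^ h) False"
  let ?F = "{B. B \<subseteq> {1..<h} \<and> card B = k}"
  have z: "?z \<in> sparse_zero k"
    by (auto simp: sparse_zero_def input_tape_def sym_of_def)
  have "set_encode B \<in> S" if B: "B \<in> ?F" for B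
  proof (rule ccontr)
    assume notin: "set_encode B \<notin> S"
    let ?x = "?z[set_encode B := True]"
    have lt: "set_encode B < 2 ^ h" using B by (intro set_encode_less_power) auto
    have "?x \<in> sparse_zero k \<longleftrightarrow> ?z \<in> sparse_zero k"
    proof (rule cert)
      fix p assume "p \<in> S"
      then have "p \<noteq> set_encode B" using notin by blast
      then show "input_tape ?z p = input_tape ?x p" by (simp add: input_tape_def)
    qed
    then have "?x \<in> sparse_zero k" using z by simp
    moreover have "input_tape ?x (set_encode B) = S1"
      using lt by (simp add: input_tape_def sym_of_def)
    ultimately show False
      using B h by (auto simp: sparse_zero_def probe_len_power)
  qed
  then have "set_encode ` ?F \<subseteq> S" by blast
  moreover have "inj_on set_encode ?F"
    by (rule inj_on_subset[OF inj_on_set_encode]) (auto intro: finite_subset)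
  ultimately have "card ?F \<le> card S" using \<open>finite S\<close> by (metis card_image card_mono)
  then show ?thesis using n_subsets[of "{1..<h}" k] by simp
qed

text \<open>On the zero string of length \<open>2 ^ (m + 1)\<close>, which leaves \<open>m\<close>
  free bits, a certificate needs at least \<open>(m / k) ^ k\<close> cells with
  \<open>k = i + 2\<close>, while a reduction would supply one of order
  \<open>m ^ (i + 1)\<close>.\<close>

lemma sparse_zero_not_reducible:
  assumes "P \<in> PPL_i i"
  shows "\<not> dlogtime_reducible (sparse_zero (i + 2)) P"
proof
  assume "dlogtime_reducible (sparse_zero (i + 2)) P"
  then obtain f where f: "dlogtime_reduction f (sparse_zero (i + 2)) P"
    by (auto simp: dlogtime_reducible_def)
  obtain C where C: "\<And>x. \<exists>S. finite S \<and> real (card S) \<le> C * log 2 (real (length x) + 2) ^ (i + 1)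
        \<and> (\<forall>x'. (\<forall>p\<in>S. input_tape x p = input_tape x' p)
            \<longrightarrow> (x' \<in> sparse_zero (i + 2) \<longleftrightarrow> x \<in> sparse_zero (i + 2)))"
    by (rule reduction_certificate[OF f assms]) blast
  define k where "k = i + 2"
  \<comment> \<open>This threshold contradicts the comparison of both bounds after cancelling
    \<open>m ^ (i + 1)\<close>. The factor 3 comes from \<open>m + 2 \<le> 3 * m\<close>; adding
    \<open>k\<close> below ensures \<open>k \<le> m\<close> for the binomial estimate.\<close>
  obtain m0 :: nat where m0: "\<bar>C\<bar> * 3 ^ (i + 1) * real k ^ k < real m0"
    using reals_Archimedean2 by blast
  define m where "m = m0 + k"
  have m: "\<bar>C\<bar> * 3 ^ (i + 1) * real k ^ k < real m" "k \<le> m" "1 \<le> m"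
    using m0 by (auto simp: m_def k_def)
  let ?z = "replicate (2 ^ (m + 1)) False"
  obtain S where S: "finite S" "real (card S) \<le> C * log 2 (real (length ?z) + 2) ^ (i + 1)"
    "\<forall>x'. (\<forall>p\<in>S. input_tape ?z p = input_tape x' p)
        \<longrightarrow> (x' \<in> sparse_zero k \<longleftrightarrow> ?z \<in> sparse_zero k)"
    using C[of ?z] unfolding k_def by (elim exE conjE)
  have "(m + 1 - 1) choose k \<le> card S"
  proof (rule sparse_zero_certificate)
    fix x' assume "\<And>p. p \<in> S \<Longrightarrow> input_tape ?z p = input_tape x' p"
    then show "x' \<in> sparse_zero k \<longleftrightarrow> ?z \<in> sparse_zero k"
      by (intro mp[OF spec[OF S(3), of x']]) (rule ballI)
  qed (use S(1) in simp_all)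
  then have "m choose k \<le> card S" by simp
  then have "real (m choose k) \<le> C * log 2 (real (length ?z) + 2) ^ (i + 1)"
    using S(2) by linarith
  also have "\<dots> \<le> \<bar>C\<bar> * (3 * real m) ^ (i + 1)"
  proof (intro mult_mono power_mono)
    show "0 \<le> log 2 (real (length ?z) + 2)" by (subst zero_le_log_cancel_iff) linarith+
    then show "0 \<le> log 2 (real (length ?z) + 2) ^ (i + 1)" by (rule zero_le_power)
    have "(2::real) \<le> 2 ^ (m + 1)" by simp
    then have "real (length ?z) + 2 \<le> 2 ^ (m + 2)" by simp
    then have "log 2 (real (length ?z) + 2) \<le> log 2 (2 ^ (m + 2))"
      by (intro log_mono) (auto simp: add_nonneg_pos)
    also have "\<dots> = real (m + 2)" by (subst log_nat_power) auto
    finally show "log 2 (real (length ?z) + 2) \<le> 3 * real m" using m(3) by simp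
  qed simp_all
  finally have upper: "real (m choose k) \<le> \<bar>C\<bar> * 3 ^ (i + 1) * real m ^ (i + 1)"
    by (simp add: power_mult_distrib mult_ac)
  have "(real m / real k) ^ k \<le> real (m choose k)"
    using binomial_ge_n_over_k_pow_k[OF m(2), where 'a = real] by simp
  then have "real m ^ k \<le> real (m choose k) * real k ^ k"
    by (simp add: power_divide divide_simps k_def)
  also have "\<dots> \<le> (\<bar>C\<bar> * 3 ^ (i + 1) * real m ^ (i + 1)) * real k ^ k"
    by (intro mult_right_mono upper) simp
  also have "\<dots> = (\<bar>C\<bar> * 3 ^ (i + 1) * real k ^ k) * real m ^ (i + 1)"
    by simp
  also have "\<dots> < real m * real m ^ (i + 1)"
    by (intro mult_strict_right_mono m(1)) (use m(3) in simp)
  finally show False by (simp add: k_def)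
qed


section \<open>A polylogarithmic RATM for the problem\<close>

text \<open>Here \<open>L\<close> is \<open>probe_len\<close> of the input length.  The machine uses tape 1 as a string of \<open>L\<close> bits, searched depth first, and tape 3 to
  recognise cell 0; their heads move in lockstep.  Tape 3 serves rather than tape 2 because heads
  of index tapes do not move in a random-access step.
  States: 0 start, 1 random access, 2 accept, 3 reject, 4 and 5 doubling search for \<open>L\<close>
  (5 also inspects the input symbol after a query), 6 rewind, \<open>7 + 2 r\<close> descend and
  \<open>8 + 2 r\<close> backtrack with \<open>r\<close> ones left to place.\<close>

definition control :: "nat \<Rightarrow> nat \<Rightarrow> sym \<Rightarrow> sym \<Rightarrow> sym \<Rightarrow> nat \<times> sym \<times> sym \<times> int" where
  "control k q a s e =
    (if q = 0 then (4, S0, S1, 1)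
     else if q = 1 then (5, s, e, 0)
     else if q = 4 then (1, S1, e, 0)
     else if q = 5 then
       (if s = S1 then (if a = Bl then (6, Bl, e, -1) else (4, S0, e, 1))
        else if a = S1 then (3, s, e, 0) else (8, s, e, -1))
     else if q = 6 then (if e = S1 then (7 + 2 * k, s, e, 1) else (6, s, e, -1))
     else if odd q then
       (if s \<noteq> Bl then (q, S0, e, 1) else if q = 7 then (1, s, e, 0) else (q + 1, s, e, -1))
     else if e = S1 then (2, s, e, 0)
     else if s = S1 then (if q < 8 + 2 * k then (q + 2, s, e, -1) else (3, s, e, 0))
     else if q = 8 then (q, s, e, -1)
     else (q - 3, S1, e, 1))"

definition search_ratm :: "nat \<Rightarrow> ratm" where
  "search_ratm k = \<lparr>ntapes = 1, nstates = 9 + 2 * k, start = 0, ra_state = 1, acc_state = 2,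
     rej_state = 3,
     delta = (\<lambda>q ss. case control k q (ss ! 0) (ss ! 1) (ss ! 3) of
       (q', s', e', d) \<Rightarrow> (q', [ss ! 0, s', ss ! 2, e'], [0, d, 0, d]))\<rparr>"

lemma ntot_search_ratm [simp]: "ntot (search_ratm k) = 4"
  by (simp add: ntot_def search_ratm_def)

lemma control_bounds:
  assumes "q < 9 + 2 * k" "control k q a s e = (q', s', e', d)"
  shows "q' < 9 + 2 * k" "d \<in> {-1, 0, 1}"
proof -
  \<comment> \<open>The top state \<open>8 + 2 * k\<close> is even, so adding 1 to an odd state or 2
    to a smaller even one stays in range.\<close>
  have "odd q \<Longrightarrow> q \<noteq> 8 + 2 * k" by auto
  then have "odd q \<Longrightarrow> q + 1 < 9 + 2 * k" using assms(1) by linarith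
  moreover have "even q \<Longrightarrow> q < 8 + 2 * k \<Longrightarrow> q + 2 < 9 + 2 * k" by presburger
  ultimately show "q' < 9 + 2 * k" "d \<in> {-1, 0, 1}"
    using assms by (auto simp: control_def split: if_splits)
qed

lemma wf_search_ratm: "wf_ratm (search_ratm k)"
  unfolding wf_ratm_def ntot_search_ratm
  using control_bounds by (auto simp: search_ratm_def split: prod.splits)

section \<open>Single steps and queries of the machine\<close>

definition mark :: "nat \<Rightarrow> sym" where
  "mark i = (if i = 0 then S1 else Bl)"

text \<open>The shape of every configuration after the first step: tape 3 permanently holds the
  marker of cell 0, and the heads of tapes 1 and 3 share the position \<open>h\<close>.\<close>

definition conf :: "bool list \<Rightarrow> nat \<Rightarrow> (nat \<Rightarrow> sym) \<Rightarrow> nat \<Rightarrow> nat \<Rightarrow> nat \<Rightarrow> config" where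
  "conf x q t h h0 h2 = (q, [input_tape x, t, \<lambda>_. Bl, mark], [h0, h, h2, h])"

lemma upt_4: "[0..<4] = [0, 1, 2, 3::nat]"
  by (simp add: upt_rec)

lemma step_control:
  assumes "q \<notin> {1, 2, 3}" "control k q (input_tape x h0) (t h) (u h) = (q', s', e', d)"
  shows "step (search_ratm k) (q, [input_tape x, t, \<lambda>_. Bl, u], [h0, h, h2, h])
    = (q', [input_tape x, t(h := s'), \<lambda>_. Bl, u(h := e')],
       [h0, nat (int h + d), h2, nat (int h + d)])"
  using assms unfolding step_def ntot_search_ratm upt_4
  by (simp add: search_ratm_def Let_def fun_upd_idem)

lemma step_conf:
  assumes "q \<notin> {1, 2, 3}" "control k q (input_tape x h0) (t h) (mark h) = (q', s', mark h, d)"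
  shows "step (search_ratm k) (conf x q t h h0 h2) = conf x q' (t(h := s')) (nat (int h + d)) h0 h2"
  using step_control[where u = mark and t = t and h = h, OF assms] by (simp add: conf_def)

lemma step_random_access:
  "step (search_ratm k) (conf x 1 t h h0 h2) = conf x 5 t h (bin_val t) (bin_val mark)"
  unfolding step_def ntot_search_ratm upt_4
  by (simp add: search_ratm_def conf_def control_def Let_def)

text \<open>The positions of the heads on tapes 0 and 2 are irrelevant except right after a
  random-access step.\<close>

definition leads :: "nat \<Rightarrow> bool list \<Rightarrow> nat \<Rightarrow> nat \<times> (nat \<Rightarrow> sym) \<times> nat \<Rightarrow> nat \<times> (nat \<Rightarrow> sym) \<times> nat \<Rightarrow> bool"
  where "leads k x b c c' \<longleftrightarrow>
    (case c of (q, t, h) \<Rightarrow> case c' of (q', t', h') \<Rightarrow>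
      \<forall>h0 h2. \<exists>s\<le>b. \<exists>h0' h2'. run (search_ratm k) s (conf x q t h h0 h2) = conf x q' t' h' h0' h2')"

lemma leads_trans:
  assumes "leads k x b c c'" "leads k x b' c' c''"
  shows "leads k x (b + b') c c''"
proof -
  obtain q t h q' t' h' q'' t'' h''
    where c: "c = (q, t, h)" "c' = (q', t', h')" "c'' = (q'', t'', h'')"
    by (metis prod_cases3)
  show ?thesis unfolding leads_def c prod.case
  proof (intro allI)
    fix h0 h2
    obtain s a2 b2 where 1: "s \<le> b" "run (search_ratm k) s (conf x q t h h0 h2) = conf x q' t' h' a2 b2"
      using assms(1) unfolding leads_def c prod.case by blast
    obtain s' a3 b3 where 2: "s' \<le> b'"
        "run (search_ratm k) s' (conf x q' t' h' a2 b2) = conf x q'' t'' h'' a3 b3"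
      using assms(2) unfolding leads_def c prod.case by blast
    have "run (search_ratm k) (s + s') (conf x q t h h0 h2) = conf x q'' t'' h'' a3 b3"
      by (simp add: run_add 1 2)
    then show "\<exists>s\<le>b + b'. \<exists>h0' h2'. run (search_ratm k) s (conf x q t h h0 h2) = conf x q'' t'' h'' h0' h2'"
      using 1(1) 2(1) add_mono by blast
  qed
qed

lemma leads_mono: "leads k x b c c' \<Longrightarrow> b \<le> b' \<Longrightarrow> leads k x b' c c'"
  by (cases c; cases c') (simp add: leads_def, meson le_trans)

text \<open>The transition is required for every input symbol \<open>a\<close>, since
  \<open>leads\<close> leaves the position of the input head open.\<close>

lemma leads_step:
  assumes "q \<notin> {1, 2, 3}" "\<And>a. control k q a (t h) (mark h) = (q', s', mark h, d)"
  shows "leads k x 1 (q, t, h) (q', t(h := s'), nat (int h + d))"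
  unfolding leads_def prod.case
proof (intro allI)
  fix h0 h2
  have "run (search_ratm k) 1 (conf x q t h h0 h2) = conf x q' (t(h := s')) (nat (int h + d)) h0 h2"
    using step_conf[where t = t and h = h, OF assms] by (simp add: run_def)
  then show "\<exists>s\<le>1. \<exists>h0' h2'. run (search_ratm k) s (conf x q t h h0 h2)
      = conf x q' (t(h := s')) (nat (int h + d)) h0' h2'"
    by blast
qed

text \<open>Three steps: enter state 1, jump, evaluate in state 5. Both phases share state 5; the
  symbol on tape 1 separates them, being \<open>S1\<close> in the doubling search and blank in the
  depth-first search.\<close>

lemma leads_query:
  assumes "q \<notin> {1, 2, 3}" "\<And>a. control k q a (t h) (mark h) = (1, s, mark h, 0)"
    and "control k 5 (input_tape x (bin_val (t(h := s)))) s (mark h) = (q', s', mark h, d)"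
  shows "leads k x 3 (q, t, h) (q', t(h := s'), nat (int h + d))"
  unfolding leads_def prod.case
proof (intro allI)
  fix h0 h2
  have "run (search_ratm k) 3 (conf x q t h h0 h2)
      = conf x q' (t(h := s')) (nat (int h + d)) (bin_val (t(h := s))) (bin_val mark)"
    using step_conf[where t = t and h = h, OF assms(1,2)]
      step_conf[where q = 5 and k = k and x = x and t = "t(h := s)" and h = h] assms(3)
    by (simp add: run_def numeral_3_eq_3 step_random_access del: One_nat_def)
  then show "\<exists>s\<le>3. \<exists>h0' h2'. run (search_ratm k) s (conf x q t h h0 h2)
      = conf x q' (t(h := s')) (nat (int h + d)) h0' h2'"
    by blast
qed

lemma bin_val_eq_set_encode:
  assumes "\<And>i. i < l \<Longrightarrow> t i \<noteq> Bl" "t l = Bl"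
  shows "bin_val t = set_encode {i. i < l \<and> t i = S1}"
proof -
  have "(LEAST m. t m = Bl) = l"
    by (rule Least_equality) (use assms in \<open>auto simp: not_less[symmetric]\<close>)
  then have "bin_val t = (\<Sum>i\<in>{..<l}. if t i = S1 then 2 ^ i else 0)" by (simp add: bin_val_def)
  also have "\<dots> = (\<Sum>i\<in>{..<l} \<inter> {i. t i = S1}. 2 ^ i)" by (simp add: sum.inter_restrict)
  also have "{..<l} \<inter> {i. t i = S1} = {i. i < l \<and> t i = S1}" by auto
  finally show ?thesis by (simp add: set_encode_def)
qed

section \<open>Doubling search for the length of the index\<close>

definition zeros :: "nat \<Rightarrow> nat \<Rightarrow> sym" where
  "zeros h i = (if i < h then S0 else Bl)"

lemma probe_index: "bin_val ((zeros h)(h := S1)) = 2 ^ h"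
proof -
  let ?t = "(zeros h)(h := S1)"
  have "bin_val ?t = set_encode {i. i < Suc h \<and> ?t i = S1}"
    by (rule bin_val_eq_set_encode) (auto simp: zeros_def)
  also have "{i. i < Suc h \<and> ?t i = S1} = {h}"
    by (auto simp: zeros_def)
  also have "set_encode {h} = 2 ^ h" by (simp add: set_encode_def)
  finally show ?thesis .
qed

lemma probe_step:
  assumes "1 \<le> h" "h < probe_len (length x)"
  shows "leads k x 3 (4, zeros h, h) (4, zeros (Suc h), Suc h)"
proof -
  have "input_tape x (2 ^ h) \<noteq> Bl"
    using less_probe_len[OF assms] by (simp add: input_tape_def sym_of_def)
  then have "leads k x 3 (4, zeros h, h) (4, (zeros h)(h := S0), nat (int h + 1))"
    by (intro leads_query[where s = S1]) (auto simp: control_def probe_index)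
  moreover have "(zeros h)(h := S0) = zeros (Suc h)" by (auto simp: zeros_def)
  ultimately show ?thesis by (simp add: nat_add_distrib)
qed

lemma probe:
  assumes "1 \<le> h" "h \<le> probe_len (length x)"
  shows "leads k x (3 * h) (4, zeros 1, 1) (4, zeros h, h)"
  using assms
proof (induction h rule: nat_induct_at_least)
  case base
  have "leads k x 0 (4, zeros 1, 1) (4, zeros 1, 1)" by (auto simp: leads_def)
  then show ?case by (rule leads_mono) simp
next
  case (Suc h)
  then have "leads k x (3 * h) (4, zeros 1, 1) (4, zeros h, h)"
    "leads k x 3 (4, zeros h, h) (4, zeros (Suc h), Suc h)"
    using probe_step by simp_all
  from leads_trans[OF this] show ?case by (simp add: add.commute)
qed

text \<open>The first blank answer erases the probing 1, which leaves exactly \<open>l\<close> zero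
  bits as the start of the depth-first search.\<close>

lemma probe_end:
  assumes "l = probe_len (length x)"
  shows "leads k x 3 (4, zeros l, l) (6, zeros l, l - 1)"
proof -
  have "input_tape x (2 ^ l) = Bl"
    using probe_len(2)[of "length x"] assms by (simp add: input_tape_def)
  then have "leads k x 3 (4, zeros l, l) (6, (zeros l)(l := Bl), nat (int l + -1))"
    by (intro leads_query[where s = S1]) (auto simp: control_def probe_index)
  moreover have "(zeros l)(l := Bl) = zeros l" by (auto simp: zeros_def)
  moreover have "nat (int l + -1) = l - 1" by simp
  ultimately show ?thesis by simp
qed

text \<open>After \<open>j\<close> moves to the left, one more step turns at the marker and stops at
  cell 1, so that bit 0 stays zero.\<close>

lemma rewind: "leads k x (Suc j) (6, zeros l, j) (7 + 2 * k, zeros l, 1)"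
proof (induction j)
  case 0
  have "leads k x 1 (6, zeros l, 0) (7 + 2 * k, (zeros l)(0 := zeros l 0), nat (int 0 + 1))"
    by (rule leads_step) (auto simp: control_def mark_def)
  then show ?case by simp
next
  case (Suc j)
  have "leads k x 1 (6, zeros l, Suc j) (6, (zeros l)(Suc j := zeros l (Suc j)), nat (int (Suc j) + -1))"
    by (rule leads_step) (auto simp: control_def mark_def)
  then have "leads k x 1 (6, zeros l, Suc j) (6, zeros l, j)" by simp
  from leads_trans[OF this Suc] show ?case by simp
qed

section \<open>Correctness and cost of the depth-first search\<close>

definition clear_below :: "bool list \<Rightarrow> nat \<Rightarrow> nat \<Rightarrow> nat set \<Rightarrow> nat \<Rightarrow> bool" where
  "clear_below x l h A r \<longleftrightarrow>
     (\<forall>B. B \<subseteq> {h..<l} \<and> card B = r \<longrightarrow> input_tape x (set_encode (A \<union> B)) \<noteq> S1)"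

lemma clear_below_base:
  "clear_below x l l A r \<longleftrightarrow> (r = 0 \<longrightarrow> input_tape x (set_encode A) \<noteq> S1)"
  by (auto simp: clear_below_def)

text \<open>Case distinction on whether bit \<open>h\<close> is set. Here \<open>A\<close> is the
  set of ones already placed below \<open>h\<close>, and \<open>r\<close> ones are still to be
  placed; the two conjuncts are the branches in the order of the search.\<close>

lemma clear_below_split:
  assumes "h < l"
  shows "clear_below x l h A r \<longleftrightarrow>
    clear_below x l (Suc h) A r \<and> (0 < r \<longrightarrow> clear_below x l (Suc h) (insert h A) (r - 1))"
proof (intro iffI conjI impI)
  assume L: "clear_below x l h A r"
  have "{Suc h..<l} \<subseteq> {h..<l}" by auto
  with L show "clear_below x l (Suc h) A r"
    unfolding clear_below_def by blast
  assume r: "0 < r"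
  show "clear_below x l (Suc h) (insert h A) (r - 1)"
    unfolding clear_below_def
  proof (intro allI impI)
    fix B assume B: "B \<subseteq> {Suc h..<l} \<and> card B = r - 1"
    then have "finite B" "h \<notin> B" by (auto intro: finite_subset)
    then have "card (insert h B) = r" "insert h B \<subseteq> {h..<l}" using B r assms by auto
    then have "input_tape x (set_encode (A \<union> insert h B)) \<noteq> S1"
      using L unfolding clear_below_def by blast
    then show "input_tape x (set_encode (insert h A \<union> B)) \<noteq> S1" by simp
  qed
next
  assume R: "clear_below x l (Suc h) A r \<and> (0 < r \<longrightarrow> clear_below x l (Suc h) (insert h A) (r - 1))"
  show "clear_below x l h A r"
    unfolding clear_below_def
  proof (intro allI impI)
    fix B assume B: "B \<subseteq> {h..<l} \<and> card B = r"
    have fin: "finite B" using B by (auto intro: finite_subset)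
    show "input_tape x (set_encode (A \<union> B)) \<noteq> S1"
    proof (cases "h \<in> B")
      case True
      have "0 < r" using B fin True by (auto simp: card_gt_0_iff)
      moreover have "card (B - {h}) = r - 1" using B True fin by simp
      moreover have "B - {h} \<subseteq> {Suc h..<l}"
        using B by (auto simp: subset_iff Suc_le_eq le_neq_implies_less)
      ultimately have "input_tape x (set_encode (insert h A \<union> (B - {h}))) \<noteq> S1"
        using R unfolding clear_below_def by blast
      moreover have "insert h A \<union> (B - {h}) = A \<union> B" using True by auto
      ultimately show ?thesis by simp
    next
      case False
      then have "B \<subseteq> {Suc h..<l}"
        using B by (auto simp: subset_iff Suc_le_eq intro!: le_neq_implies_less)
      then show ?thesis using R B unfolding clear_below_def by blast
    qed
  qed
qed

text \<open>A leaf is charged the 3 steps of a query. An inner node costs one step down and one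
  back, plus one to switch branches when a 1 can still be placed.\<close>

fun search_time :: "nat \<Rightarrow> nat \<Rightarrow> nat" where
  "search_time 0 r = 3"
| "search_time (Suc n) 0 = 2 + search_time n 0"
| "search_time (Suc n) (Suc r) = 3 + search_time n (Suc r) + search_time n r"

text \<open>Adding 3 turns the branching case into a Pascal-type recurrence: the shifted value is
  the sum of the two shifted values below it.\<close>

lemma search_time_le: "search_time n r + 3 \<le> 6 * (n + 1) ^ (r + 1)"
proof (induction n r rule: search_time.induct)
  case (3 n r)
  have "search_time (Suc n) (Suc r) + 3 \<le> 6 * (n + 1) ^ (r + 2) + 6 * (n + 1) ^ (r + 1)"
    using 3 by simp
  also have "\<dots> = 6 * ((n + 1) ^ (r + 1) * (n + 2))" by (simp add: algebra_simps)
  also have "\<dots> \<le> 6 * ((n + 2) ^ (r + 1) * (n + 2))"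
    by (intro mult_le_mono power_mono) auto
  finally show ?case by (simp add: algebra_simps)
qed auto

definition bits :: "nat \<Rightarrow> (nat \<Rightarrow> sym) \<Rightarrow> bool" where
  "bits l t \<longleftrightarrow> (\<forall>i<l. t i \<noteq> Bl) \<and> t l = Bl"

text \<open>Induction on the number \<open>n\<close> of free bits. A successful return keeps the
  bits below \<open>h\<close>, so a caller can read off its branch. Bits from \<open>h\<close> on
  may be stale; the next descent overwrites them with 0.\<close>

lemma search:
  assumes "h + n = l" "1 \<le> h" "bits l t" "r \<le> k"
  shows "if clear_below x l h {i. i < h \<and> t i = S1} r
    then \<exists>t'. leads k x (search_time n r) (7 + 2 * r, t, h) (8 + 2 * r, t', h - 1)
           \<and> bits l t' \<and> (\<forall>i<h. t' i = t i)
    else \<exists>t' h'. leads k x (search_time n r) (7 + 2 * r, t, h) (3, t', h')"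
  using assms
proof (induction n arbitrary: h t r)
  case 0
  then have hl: "h = l" and t: "t h = Bl" and h: "0 < h" by (auto simp: bits_def)
  have idx: "bin_val t = set_encode {i. i < h \<and> t i = S1}"
    by (rule bin_val_eq_set_encode) (use 0 in \<open>auto simp: bits_def\<close>)
  have left: "nat (int h + -1) = h - 1" by simp
  have upd: "t(h := Bl) = t" using t by auto
  show ?case
  proof (cases "r = 0")
    \<comment> \<open>A leaf with ones still missing is no probed position, so the machine
      backtracks without a query.\<close>
    case False
    have "leads k x 1 (7 + 2 * r, t, h) (8 + 2 * r, t(h := Bl), nat (int h + -1))"
      by (rule leads_step) (use t False in \<open>auto simp: control_def\<close>)
    then have "leads k x 3 (7 + 2 * r, t, h) (8 + 2 * r, t, h - 1)"
      unfolding upd left by (rule leads_mono) simp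
    then show ?thesis using False 0 by (auto simp: hl clear_below_base)
  next
    case r: True
    show ?thesis
    proof (cases "input_tape x (bin_val t) = S1")
      case True
      have "leads k x 3 (7 + 2 * r, t, h) (3, t(h := Bl), nat (int h + 0))"
        by (rule leads_query[where s = Bl]) (use t r True upd in \<open>auto simp: control_def\<close>)
      then show ?thesis using r True idx by (auto simp: hl clear_below_base)
    next
      case False
      have "leads k x 3 (7 + 2 * r, t, h) (8 + 2 * r, t(h := Bl), nat (int h + -1))"
        by (rule leads_query[where s = Bl]) (use t r False upd in \<open>auto simp: control_def\<close>)
      then show ?thesis unfolding upd left using r False idx 0 by (auto simp: hl clear_below_base)
    qed
  qed
next
  case (Suc n)
  let ?A = "{i. i < h \<and> t i = S1}"
  have hl: "h < l" and h: "mark h = Bl" "0 < h" using Suc.prems by (auto simp: mark_def)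
  note split = clear_below_split[OF hl, of x ?A r]
  let ?t0 = "t(h := S0)"
  have t0: "bits l ?t0" using Suc.prems hl by (auto simp: bits_def)
  have A0: "{i. i < Suc h \<and> ?t0 i = S1} = ?A" by (auto simp: less_Suc_eq)
  have "leads k x 1 (7 + 2 * r, t, h) (7 + 2 * r, ?t0, nat (int h + 1))"
    by (rule leads_step) (use Suc.prems hl in \<open>auto simp: control_def bits_def\<close>)
  then have down0: "leads k x 1 (7 + 2 * r, t, h) (7 + 2 * r, ?t0, Suc h)"
    by (simp add: nat_add_distrib)
  note IH0 = Suc.IH[of "Suc h" ?t0 r, unfolded A0]
  show ?case
  proof (cases "clear_below x l (Suc h) ?A r")
    case False
    then obtain t' h' where "leads k x (search_time n r) (7 + 2 * r, ?t0, Suc h) (3, t', h')"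
      using IH0 Suc.prems t0 by (auto simp del: fun_upd_apply)
    from leads_trans[OF down0 this]
    have "leads k x (search_time (Suc n) r) (7 + 2 * r, t, h) (3, t', h')"
      by (rule leads_mono) (cases r, auto)
    then show ?thesis using False split by auto
  next
    case True
    then obtain t' where t': "leads k x (search_time n r) (7 + 2 * r, ?t0, Suc h) (8 + 2 * r, t', h)"
        "bits l t'" "\<forall>i<Suc h. t' i = ?t0 i"
      using IH0 Suc.prems t0 by (auto simp del: fun_upd_apply)
    note back0 = leads_trans[OF down0 t'(1)]
    \<comment> \<open>The 0 found on return shows that only the first branch is done.\<close>
    have t'h: "t' h = S0" using t'(3) by simp
    have left: "nat (int h + -1) = h - 1" by simp
    show ?thesis
    proof (cases r)
      case 0
      have "leads k x 1 (8 + 2 * r, t', h) (8 + 2 * r, t'(h := S0), nat (int h + -1))"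
        by (rule leads_step) (use t'h 0 h in \<open>auto simp: control_def\<close>)
      moreover have "t'(h := S0) = t'" using t'h by auto
      ultimately have "leads k x 1 (8 + 2 * r, t', h) (8 + 2 * r, t', h - 1)"
        unfolding left by simp
      from leads_trans[OF back0 this]
      have "leads k x (search_time (Suc n) r) (7 + 2 * r, t, h) (8 + 2 * r, t', h - 1)"
        by (rule leads_mono) (simp add: 0)
      then show ?thesis using True split 0 t'(2,3) by auto
    next
      case r: (Suc r')
      let ?t1 = "t'(h := S1)"
      have t1: "bits l ?t1" using t'(2) hl by (auto simp: bits_def)
      have A1: "{i. i < Suc h \<and> ?t1 i = S1} = insert h ?A"
        using t'(3) by (auto simp: less_Suc_eq)
      note IH1 = Suc.IH[of "Suc h" ?t1 r', unfolded A1]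
      \<comment> \<open>Moving from \<open>8 + 2 * r\<close> to
        \<open>q - 3 = 7 + 2 * (r - 1)\<close> spends one of the remaining ones on bit
        \<open>h\<close>.\<close>
      have "leads k x 1 (8 + 2 * r, t', h) (7 + 2 * r', ?t1, nat (int h + 1))"
        by (rule leads_step) (use t'h r h in \<open>auto simp: control_def\<close>)
      then have "leads k x 1 (8 + 2 * r, t', h) (7 + 2 * r', ?t1, Suc h)"
        by (simp add: nat_add_distrib)
      note down1 = leads_trans[OF back0 this]
      show ?thesis
      proof (cases "clear_below x l (Suc h) (insert h ?A) r'")
        case False
        then obtain t'' h' where "leads k x (search_time n r') (7 + 2 * r', ?t1, Suc h) (3, t'', h')"
          using IH1 Suc.prems t1 r by (auto simp del: fun_upd_apply)
        from leads_trans[OF down1 this]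
        have "leads k x (search_time (Suc n) r) (7 + 2 * r, t, h) (3, t'', h')"
          by (rule leads_mono) (simp add: r)
        then show ?thesis using False split r by auto
      next
        case clear: True
        then obtain t'' where t'': "leads k x (search_time n r') (7 + 2 * r', ?t1, Suc h) (8 + 2 * r', t'', h)"
            "bits l t''" "\<forall>i<Suc h. t'' i = ?t1 i"
          using IH1 Suc.prems t1 r by (auto simp del: fun_upd_apply)
        have t''h: "t'' h = S1" using t''(3) by simp
        \<comment> \<open>Reading 1 means that both branches are done, and the spent one is given
          back. The guard \<open>q < 8 + 2 * k\<close> holds as
          \<open>r' < r \<le> k\<close>.\<close>
        have "leads k x 1 (8 + 2 * r', t'', h) (8 + 2 * r, t''(h := S1), nat (int h + -1))"
          by (rule leads_step) (use t''h r h Suc.prems(4) in \<open>auto simp: control_def\<close>)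
        moreover have "t''(h := S1) = t''" using t''h by auto
        ultimately have "leads k x 1 (8 + 2 * r', t'', h) (8 + 2 * r, t'', h - 1)"
          unfolding left by simp
        from leads_trans[OF leads_trans[OF down1 t''(1)] this]
        have "leads k x (search_time (Suc n) r) (7 + 2 * r, t, h) (8 + 2 * r, t'', h - 1)"
          by (rule leads_mono) (simp add: r)
        then show ?thesis using True clear split r t''(2,3) t'(3) by auto
      qed
    qed
  qed
qed

section \<open>The complete run and its polylogarithmic time bound\<close>

lemma search_ratm_answer:
  assumes "l = probe_len (length x)"
  shows "\<exists>s t h h0 h2. s \<le> 4 * l + 6 + search_time (l - 1) k \<and>
    run (search_ratm k) s (init (search_ratm k) x [])
      = conf x (if x \<in> sparse_zero k then 2 else 3) t h h0 h2"
proof -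
  let ?M = "search_ratm k"
  have l: "1 \<le> l" using probe_len(1) assms by simp
  have "init ?M x [] = (0, [input_tape x, \<lambda>_. Bl, \<lambda>_. Bl, \<lambda>_. Bl], [0, 0, 0, 0])"
    unfolding init_def ntot_search_ratm upt_4
    by (simp add: search_ratm_def list_tape_def fun_eq_iff eval_nat_numeral)
  moreover have "(\<lambda>_. Bl)(0 := S0) = zeros 1" "(\<lambda>_. Bl)(0 := S1) = mark"
    by (auto simp: zeros_def mark_def)
  ultimately have first: "step ?M (init ?M x []) = conf x 4 (zeros 1) 1 0 0"
    using step_control[of 0 k x 0 "\<lambda>_. Bl" 0 "\<lambda>_. Bl" 4 S0 S1 1]
    by (simp add: control_def conf_def)
  have "leads k x (3 * l) (4, zeros 1, 1) (4, zeros l, l)"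
    using probe l assms by simp
  from leads_trans[OF leads_trans[OF this probe_end[OF assms]] rewind]
  have prep: "leads k x (3 * l + 3 + Suc (l - 1)) (4, zeros 1, 1) (7 + 2 * k, zeros l, 1)" .
  have clear: "clear_below x l 1 {i. i < 1 \<and> zeros l i = S1} k \<longleftrightarrow> x \<in> sparse_zero k"
    using assms by (simp add: clear_below_def sparse_zero_def zeros_def)
  have "bits l (zeros l)" by (simp add: bits_def zeros_def)
  then have dfs: "if x \<in> sparse_zero k
    then \<exists>t'. leads k x (search_time (l - 1) k) (7 + 2 * k, zeros l, 1) (8 + 2 * k, t', 0)
    else \<exists>t' h'. leads k x (search_time (l - 1) k) (7 + 2 * k, zeros l, 1) (3, t', h')"
    using search[of 1 "l - 1" l "zeros l" k k x] l clear by (auto split: if_splits)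
  have "\<exists>t h. leads k x (search_time (l - 1) k + 1) (7 + 2 * k, zeros l, 1)
      (if x \<in> sparse_zero k then 2 else 3, t, h)"
  proof (cases "x \<in> sparse_zero k")
    case True
    then obtain t' where t': "leads k x (search_time (l - 1) k) (7 + 2 * k, zeros l, 1) (8 + 2 * k, t', 0)"
      using dfs by auto
    \<comment> \<open>Backtracking out of cell 1 reaches the marker at cell 0, which means that the
      whole tree has been searched, and the machine accepts.\<close>
    have "leads k x 1 (8 + 2 * k, t', 0) (2, t'(0 := t' 0), nat (int 0 + 0))"
      by (rule leads_step) (auto simp: control_def mark_def)
    from leads_trans[OF t' this] show ?thesis using True by auto
  next
    case False
    then obtain t' h' where "leads k x (search_time (l - 1) k) (7 + 2 * k, zeros l, 1) (3, t', h')"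
      using dfs by auto
    from leads_mono[OF this, of "search_time (l - 1) k + 1"] show ?thesis using False by auto
  qed
  then obtain t h where "leads k x (search_time (l - 1) k + 1) (7 + 2 * k, zeros l, 1)
      (if x \<in> sparse_zero k then 2 else 3, t, h)" by blast
  from leads_trans[OF prep this]
  obtain s h0 h2 where s: "s \<le> 3 * l + 3 + Suc (l - 1) + (search_time (l - 1) k + 1)"
    "run ?M s (conf x 4 (zeros 1) 1 0 0) = conf x (if x \<in> sparse_zero k then 2 else 3) t h h0 h2"
    unfolding leads_def prod.case by blast
  have "run ?M (1 + s) (init ?M x []) = conf x (if x \<in> sparse_zero k then 2 else 3) t h h0 h2"
    unfolding run_add using s(2) first by (simp add: run_def)
  moreover have "1 + s \<le> 4 * l + 6 + search_time (l - 1) k" using s(1) l by simp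
  ultimately show ?thesis by blast
qed

lemma sparse_zero_in_PPL: "sparse_zero k \<in> PPL"
proof -
  have "answers_within (search_ratm k) x [] (16 * 2 ^ (k + 1) * log 2 (real (length x) + 2) ^ (k + 1))
      (x \<in> sparse_zero k)" for x
  proof -
    define l where "l = probe_len (length x)"
    define g where "g = log 2 (real (length x) + 2)"
    have g: "1 \<le> g" by (simp add: g_def le_log_iff)
    have l1: "1 \<le> l" using probe_len(1) by (simp add: l_def)
    obtain s t h h0 h2 where s: "s \<le> 4 * l + 6 + search_time (l - 1) k"
      "run (search_ratm k) s (init (search_ratm k) x [])
        = conf x (if x \<in> sparse_zero k then 2 else 3) t h h0 h2"
      using search_ratm_answer[OF l_def, of k] by blast
    have "l \<le> l ^ (k + 1)" using l1 by (simp add: self_le_power)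
    moreover have "search_time (l - 1) k + 3 \<le> 6 * l ^ (k + 1)"
      using search_time_le[of "l - 1" k] l1 by simp
    \<comment> \<open>Since \<open>1 \<le> l \<le> l ^ (k + 1)\<close>, the coefficients 4, 6 and 6
      add up to 16.\<close>
    ultimately have "s \<le> 16 * l ^ (k + 1)" using s(1) l1 by linarith
    then have "real s \<le> real (16 * l ^ (k + 1))" by (simp only: of_nat_le_iff)
    also have "\<dots> = 16 * real l ^ (k + 1)" by simp
    also have "\<dots> \<le> 16 * (2 * g) ^ (k + 1)"
    proof (intro mult_left_mono power_mono)
      have "real l \<le> 1 + g" using probe_len_le_log by (simp add: l_def g_def)
      then show "real l \<le> 2 * g" using g by linarith
    qed simp_all
    also have "\<dots> = 16 * 2 ^ (k + 1) * g ^ (k + 1)" by (simp add: power_mult_distrib)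
    finally have "real s \<le> 16 * 2 ^ (k + 1) * g ^ (k + 1)" .
    with s(2) show ?thesis
      unfolding answers_within_def g_def
      by (intro exI[of _ s]) (simp add: conf_def search_ratm_def)
  qed
  then have "sparse_zero k \<in> PPL_i (k + 1)"
    unfolding PPL_i_def using wf_search_ratm by blast
  then show ?thesis unfolding PPL_def by (intro UN_I[of "k + 1"]) auto
qed

theorem mainTheorem11:
  shows "\<not> (\<exists>P \<in> PPL. \<forall>Q \<in> PPL. dlogtime_reducible Q P)"
proof
  assume "\<exists>P \<in> PPL. \<forall>Q \<in> PPL. dlogtime_reducible Q P"
  then obtain P i where "P \<in> PPL_i i" "\<And>Q. Q \<in> PPL \<Longrightarrow> dlogtime_reducible Q P"
    unfolding PPL_def by blast
  then show False using sparse_zero_not_reducible sparse_zero_in_PPL by blast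
qed

end
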